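(* Let $a<b$ and $c<d$ be real numbers, let $\Delta := [a,b]\times[c,d]\subset\mathbb{R}^2$, and let $f:\Delta\to\mathbb{R}$ be a partial differentiable mapping on $\Delta$. Let $q>1$ and let $p$ satisfy $\frac1p+\frac1q=1$. If $\left|\dfrac{\partial^2 f}{\partial t\partial s}\right|^q$ is a convex function on the co-ordinates on $\Delta$, then $$\left|\frac{f(a,c)+f(a,d)+f(b,c)+f(b,d)}{4}+\frac{1}{(b-a)(d-c)}\int_a^b\int_c^d f(x,y)\,dy\,dx-A\right|$$ $$\le\frac{(b-a)(d-c)}{4(p+1)^{\frac2p}}\left(\frac{\left|\frac{\partial^2 f}{\partial t\partial s}(a,c)\right|^q+\left|\frac{\partial^2 f}{\partial t\partial s}(a,d)\right|^q+\left|\frac{\partial^2 f}{\partial t\partial s}(b,c)\right|^q+\left|\frac{\partial^2 f}{\partial t\partial s}(b,d)\right|^q}{4}\right)^{\frac1q},$$ where $$A=\frac12\left[\frac{1}{b-a}\int_a^b\left[f(x,c)+f(x,d)\right]dx+\frac{1}{d-c}\int_c^d\left[f(a,y)+f(b,y)\right]dy\right].$$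
   Context: "Partial differentiable mapping on $\Delta$" means that the first-order partial derivatives of $f$ and the mixed second-order partial derivative $\frac{\partial^2 f}{\partial t\partial s}$ exist at every point of $\Delta$ (one-sided derivatives being used at the boundary). Here $\frac{\partial^2 f}{\partial t\partial s}$ denotes the mixed partial derivative of $f$ with respect to its own two variables ($t$ standing for the first variable and $s$ for the second): $f$ is differentiated first in the second variable, then in the first. A function $g:\Delta\to\mathbb{R}$ is convex on the co-ordinates (co-ordinated convex) on $\Delta$ if for all $t,s\in[0,1]$, all $x,y\in[a,b]$ and all $u,v\in[c,d]$, $$g(tx+(1-t)y,\,su+(1-s)v)\le ts\,g(x,u)+s(1-t)\,g(y,u)+t(1-s)\,g(x,v)+(1-t)(1-s)\,g(y,v).$$ Equivalently, the partial mappings $u\mapsto g(u,y)$ on $[a,b]$ and $v\mapsto g(x,v)$ on $[c,d]$ are convex for all $y\in[c,d]$ and $x\in[a,b]$. *)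

theory Defs
  imports "HOL-Analysis.Analysis"
begin

text \<open>
  Partial derivatives of a function on a rectangle \<open>X \<times> Y\<close>, where \<open>X\<close> and \<open>Y\<close> are
  nondegenerate compact intervals. Differentiating within \<open>X\<close> (resp. \<open>Y\<close>) gives the ordinary
  derivative at interior points and the one-sided derivative at the end points, and makes the
  values of \<open>f\<close> outside the rectangle irrelevant.
\<close>

definition partial_fst :: "real set \<Rightarrow> (real \<times> real \<Rightarrow> real) \<Rightarrow> real \<times> real \<Rightarrow> real" where
  "partial_fst X f = (\<lambda>(x, y). vector_derivative (\<lambda>u. f (u, y)) (at x within X))"

definition partial_snd :: "real set \<Rightarrow> (real \<times> real \<Rightarrow> real) \<Rightarrow> real \<times> real \<Rightarrow> real" where
  "partial_snd Y f = (\<lambda>(x, y). vector_derivative (\<lambda>v. f (x, v)) (at y within Y))"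

definition mixed_partial ::
    "real set \<Rightarrow> real set \<Rightarrow> (real \<times> real \<Rightarrow> real) \<Rightarrow> real \<times> real \<Rightarrow> real" where
  "mixed_partial X Y f = partial_fst X (partial_snd Y f)"

text \<open>
  Only pointwise existence is required: neither continuity nor integrability of any of the
  derivatives is assumed.
\<close>

definition partial_differentiable_on ::
    "(real \<times> real \<Rightarrow> real) \<Rightarrow> real set \<Rightarrow> real set \<Rightarrow> bool" where
  "partial_differentiable_on f X Y \<longleftrightarrow>
     (\<forall>x\<in>X. \<forall>y\<in>Y.
        (\<lambda>u. f (u, y)) differentiable (at x within X) \<and>
        (\<lambda>v. f (x, v)) differentiable (at y within Y) \<and>
        (\<lambda>u. partial_snd Y f (u, y)) differentiable (at x within X))"

definition coordinated_convex_on ::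
    "real set \<Rightarrow> real set \<Rightarrow> (real \<times> real \<Rightarrow> real) \<Rightarrow> bool" where
  "coordinated_convex_on X Y g \<longleftrightarrow>
     (\<forall>t\<in>{0..1}. \<forall>s\<in>{0..1}. \<forall>x\<in>X. \<forall>y\<in>X. \<forall>u\<in>Y. \<forall>v\<in>Y.
        g (t * x + (1 - t) * y, s * u + (1 - s) * v)
          \<le> t * s * g (x, u) + s * (1 - t) * g (y, u)
             + t * (1 - s) * g (x, v) + (1 - t) * (1 - s) * g (y, v))"

end

theory Submission
  imports Defs
begin

text \<open>
  The left-hand side is the tensor square of the one-dimensional trapezoid defect
  \<open>(\<phi> a + \<phi> b) / 2 - mean \<phi>\<close>, applied first in \<open>y\<close> and then in \<open>x\<close>. If the increments of \<open>\<phi>\<close>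
  are dominated by those of an antiderivative of a continuous \<open>k\<close>, integration by parts bounds
  the defect by the mean of \<open>\<bar>x - (a + b) / 2\<bar> * k x\<close>. Coordinated convexity dominates the mixed
  partial derivative by the \<open>q\<close>-th root \<open>k\<close> of the bilinear interpolant of the corner values of
  its \<open>q\<close>-th power, and the mean value inequality, used once per variable, dominates the mixed
  differences of \<open>f\<close> by the double integral of \<open>k\<close>; so no measurability of the mixed partial
  derivative is ever needed. The weighted integral of \<open>k\<close> is estimated by Hoelder's inequality in
  one variable at a time, because averaging a bilinear function in one variable leaves an affine
  function of the other.
\<close>

section \<open>The trapezoid defect on an interval and on a rectangle\<close>

lemma continuous_on_curried_compose:
  assumes "continuous_on (X \<times> Y) (\<lambda>(x, y). k x y)"
    and "continuous_on S g" "continuous_on S h" "g ` S \<subseteq> X" "h ` S \<subseteq> Y"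
  shows "continuous_on S (\<lambda>z. k (g z) (h z))"
  using continuous_on_compose2[OF assms(1), of S "\<lambda>z. (g z, h z)"] assms
  by (force intro: continuous_on_Pair)

text \<open>Cut at the midpoint \<open>m\<close>: the defect is the integral of
  \<open>\<phi> a - \<phi> x\<close> over the left half plus that of
  \<open>\<phi> b - \<phi> x\<close> over the right half, and both integrands are dominated by
  increments of the antiderivative \<open>K\<close> of \<open>k\<close>. The hypothesis speaks of
  increments because the lemma is later applied to an integral over \<open>y\<close>, viewed as a
  function of \<open>x\<close>, whose differentiability is not known.\<close>

lemma trapezoid_defect_le:
  fixes \<phi> k :: "real \<Rightarrow> real"
  assumes "a < b" and contk: "continuous_on {a..b} k"
    and incr: "\<And>u v. a \<le> u \<Longrightarrow> u \<le> v \<Longrightarrow> v \<le> b \<Longrightarrow> \<bar>\<phi> v - \<phi> u\<bar> \<le> integral {u..v} k"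
  shows "\<phi> integrable_on {a..b}"
    and "\<bar>(b - a) * (\<phi> a + \<phi> b) / 2 - integral {a..b} \<phi>\<bar>
           \<le> integral {a..b} (\<lambda>x. \<bar>x - (a + b) / 2\<bar> * k x)"
proof -
  define K where "K x = integral {a..x} k" for x
  define m where "m = (a + b) / 2"
  have m: "a < m" "m < b" "m - a = (b - a) / 2" "b - m = (b - a) / 2"
    using \<open>a < b\<close> by (auto simp: m_def field_simps)
  have K': "(K has_vector_derivative k x) (at x within {a..b})" if "x \<in> {a..b}" for x
    unfolding K_def using integral_has_vector_derivative[OF contk that] .
  have contK: "continuous_on {a..b} K"
    using K' continuous_on_vector_derivative by blast
  have incrK: "\<bar>\<phi> v - \<phi> u\<bar> \<le> K v - K u" if "a \<le> u" "u \<le> v" "v \<le> b" for u v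
  proof -
    have "k integrable_on {a..v}"
      using that by (intro integrable_continuous_real continuous_on_subset[OF contk]) auto
    then have "K u + integral {u..v} k = K v"
      unfolding K_def using that by (intro Henstock_Kurzweil_Integration.integral_combine) auto
    then show ?thesis using incr[OF that] by simp
  qed
  \<comment> \<open>Continuity is inherited from \<open>K\<close>, since
    \<open>\<bar>\<phi> y - \<phi> x\<bar> \<le> \<bar>K y - K x\<bar>\<close> on either side of
    \<open>x\<close>.\<close>
  have cont\<phi>: "continuous_on {a..b} \<phi>"
    unfolding continuous_on_def
  proof (intro ballI)
    fix x assume x: "x \<in> {a..b}"
    have "((\<lambda>y. \<bar>K y - K x\<bar>) \<longlongrightarrow> \<bar>K x - K x\<bar>) (at x within {a..b})"
      using contK x by (intro tendsto_intros) (auto simp: continuous_on_def)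
    then have "((\<lambda>y. \<phi> y - \<phi> x) \<longlongrightarrow> 0) (at x within {a..b})"
    proof (rule Lim_null_comparison[rotated, OF tendsto_eq_rhs])
      show "\<forall>\<^sub>F y in at x within {a..b}. norm (\<phi> y - \<phi> x) \<le> \<bar>K y - K x\<bar>"
        unfolding eventually_at_filter
      proof (rule always_eventually, intro allI impI)
        fix y assume "y \<in> {a..b}"
        then show "norm (\<phi> y - \<phi> x) \<le> \<bar>K y - K x\<bar>"
          using incrK[of x y] incrK[of y x] x by (cases "x \<le> y") auto
      qed
    qed simp
    then show "(\<phi> \<longlongrightarrow> \<phi> x) (at x within {a..b})"
      by (simp add: LIM_zero_iff)
  qed
  then show int\<phi>: "\<phi> integrable_on {a..b}"
    by (rule integrable_continuous_real)
  have sub: "continuous_on S g" if "continuous_on {a..b} g" "S \<subseteq> {a..b}" for g :: "real \<Rightarrow> real" and S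
    using that continuous_on_subset by blast
  have split: "integral {a..b} g = integral {a..m} g + integral {m..b} g"
    if "continuous_on {a..b} g" for g :: "real \<Rightarrow> real"
    using Henstock_Kurzweil_Integration.integral_combine[of a m b g] integrable_continuous_real[OF that] m by simp
  \<comment> \<open>Integration by parts with \<open>(x - m) * K x\<close>, which vanishes at
    \<open>m\<close>: on each half only the boundary term at \<open>a\<close> or \<open>b\<close>
    survives.\<close>
  have parts: "((\<lambda>x. K x + (x - m) * k x) has_integral ((v - m) * K v - (u - m) * K u)) {u..v}"
    if "a \<le> u" "u \<le> v" "v \<le> b" for u v
  proof (rule fundamental_theorem_of_calculus)
    fix x assume x: "x \<in> {u..v}"
    then have "(K has_real_derivative k x) (at x within {u..v})"
      using K'[of x] that has_vector_derivative_within_subset[of K "k x" x "{a..b}" "{u..v}"]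
      by (auto simp: has_real_derivative_iff_has_vector_derivative)
    then show "((\<lambda>x. (x - m) * K x) has_vector_derivative K x + (x - m) * k x) (at x within {u..v})"
      unfolding has_real_derivative_iff_has_vector_derivative[symmetric]
      by (auto intro!: derivative_eq_intros)
  qed (use that in simp)
  have cont_subs: "continuous_on {a..m} g" "continuous_on {m..b} g"
      if "continuous_on {a..b} g" for g :: "real \<Rightarrow> real"
    using sub[OF that] m by auto
  note int_subs = cont_subs[THEN integrable_continuous_real]
  have wk: "continuous_on {a..b} (\<lambda>x. (x - m) * k x)"
    by (intro continuous_intros contk)
  have R: "integral {m..b} K + integral {m..b} (\<lambda>x. (x - m) * k x) = (b - m) * K b"
    using integral_unique[OF parts[of m b]] m(1,2)
    by (simp add: integral_add int_subs[OF contK] int_subs[OF wk])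
  have L: "integral {a..m} K + integral {a..m} (\<lambda>x. (x - m) * k x) = (m - a) * K a"
    using integral_unique[OF parts[of a m]] m(1,2)
    by (simp add: integral_add int_subs[OF contK] int_subs[OF wk] flip: mult_minus_left)
  have "integral {a..m} (\<lambda>x. \<bar>x - m\<bar> * k x) = integral {a..m} (\<lambda>x. - ((x - m) * k x))"
    by (rule integral_cong) (auto simp: algebra_simps)
  moreover have "integral {m..b} (\<lambda>x. \<bar>x - m\<bar> * k x) = integral {m..b} (\<lambda>x. (x - m) * k x)"
    by (rule integral_cong) auto
  \<comment> \<open>The weighted integral is thus the total deviation of \<open>K\<close> from
    \<open>K a\<close> on the left half and from \<open>K b\<close> on the right half, exactly what
    bounds the two pieces of the defect of \<open>\<phi>\<close>.\<close>
  ultimately have rhs: "integral {a..b} (\<lambda>x. \<bar>x - m\<bar> * k x)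
      = (integral {a..m} K - (m - a) * K a) + ((b - m) * K b - integral {m..b} K)"
    using split[of "\<lambda>x. \<bar>x - m\<bar> * k x"] L R
    by (simp add: continuous_intros contk)
  have left: "\<bar>(m - a) * \<phi> a - integral {a..m} \<phi>\<bar> \<le> integral {a..m} K - (m - a) * K a"
  proof -
    have "norm (integral {a..m} (\<lambda>x. \<phi> a - \<phi> x)) \<le> integral {a..m} (\<lambda>x. K x - K a)"
    proof (rule integral_norm_bound_integral)
      fix x assume "x \<in> {a..m}"
      then show "norm (\<phi> a - \<phi> x) \<le> K x - K a"
        using incrK[of a x] m by auto
    qed (use int_subs[OF contK] int_subs[OF cont\<phi>] in \<open>auto intro!: integrable_diff\<close>)
    then show ?thesis
      using m(1,2) by (simp add: integral_diff integrable_const_ivl int_subs[OF contK] int_subs[OF cont\<phi>])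
  qed
  have right: "\<bar>(b - m) * \<phi> b - integral {m..b} \<phi>\<bar> \<le> (b - m) * K b - integral {m..b} K"
  proof -
    have "norm (integral {m..b} (\<lambda>x. \<phi> b - \<phi> x)) \<le> integral {m..b} (\<lambda>x. K b - K x)"
    proof (rule integral_norm_bound_integral)
      fix x assume "x \<in> {m..b}"
      then show "norm (\<phi> b - \<phi> x) \<le> K b - K x"
        using incrK[of x b] m by auto
    qed (use int_subs[OF contK] int_subs[OF cont\<phi>] in \<open>auto intro!: integrable_diff\<close>)
    then show ?thesis
      using m(1,2) by (simp add: integral_diff integrable_const_ivl int_subs[OF contK] int_subs[OF cont\<phi>])
  qed
  have "(b - a) * (\<phi> a + \<phi> b) / 2 - integral {a..b} \<phi>
      = ((m - a) * \<phi> a - integral {a..m} \<phi>) + ((b - m) * \<phi> b - integral {m..b} \<phi>)"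
    unfolding split[OF cont\<phi>] m(3,4) by (simp add: field_simps)
  then show "\<bar>(b - a) * (\<phi> a + \<phi> b) / 2 - integral {a..b} \<phi>\<bar>
           \<le> integral {a..b} (\<lambda>x. \<bar>x - (a + b) / 2\<bar> * k x)"
    unfolding m_def[symmetric] rhs using left right by linarith
qed

text \<open>The quantity bounded is the \<open>x\<close>-defect of \<open>\<Phi>\<close>, itself the
  \<open>y\<close>-defect of \<open>f x\<close>, with both defects multiplied by the interval
  lengths. By linearity an increment of \<open>\<Phi>\<close> is the \<open>y\<close>-defect of
  \<open>f x' y - f x y\<close>, whose own increments are mixed differences; so the one-dimensional
  lemma applies first in \<open>y\<close>, then in \<open>x\<close>.\<close>

lemma rectangle_trapezoid_defect_le:
  fixes f k :: "real \<Rightarrow> real \<Rightarrow> real"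
  assumes "a < b" "c < d"
    and contk: "continuous_on ({a..b} \<times> {c..d}) (\<lambda>(x, y). k x y)"
    and cont1: "\<And>y. y \<in> {c..d} \<Longrightarrow> continuous_on {a..b} (\<lambda>x. f x y)"
    and cont2: "\<And>x. x \<in> {a..b} \<Longrightarrow> continuous_on {c..d} (f x)"
    and incr: "\<And>x x' y y'. \<lbrakk>a \<le> x; x \<le> x'; x' \<le> b; c \<le> y; y \<le> y'; y' \<le> d\<rbrakk> \<Longrightarrow>
       \<bar>(f x' y' - f x y') - (f x' y - f x y)\<bar> \<le> integral {y..y'} (\<lambda>v. integral {x..x'} (\<lambda>s. k s v))"
  shows "\<bar>(b - a) * (d - c) * ((f a c + f a d + f b c + f b d) / 4)
           + integral {a..b} (\<lambda>x. integral {c..d} (f x))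
           - ((d - c) * integral {a..b} (\<lambda>x. f x c + f x d)
              + (b - a) * integral {c..d} (\<lambda>y. f a y + f b y)) / 2\<bar>
         \<le> integral {a..b} (\<lambda>x. \<bar>x - (a + b) / 2\<bar> * integral {c..d} (\<lambda>y. \<bar>y - (c + d) / 2\<bar> * k x y))"
proof -
  define \<Phi> where "\<Phi> x = (d - c) * (f x c + f x d) / 2 - integral {c..d} (f x)" for x
  define \<kappa> where "\<kappa> x = integral {c..d} (\<lambda>y. \<bar>y - (c + d) / 2\<bar> * k x y)" for x
  note contk' = continuous_on_curried_compose[OF contk]
  have intf: "f x integrable_on {c..d}" if "x \<in> {a..b}" for x
    using cont2[OF that] by (rule integrable_continuous_real)
  have cont\<kappa>: "continuous_on {a..b} \<kappa>"
  proof -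
    have "continuous_on ({a..b} \<times> cbox c d) (\<lambda>(x, y). \<bar>y - (c + d) / 2\<bar> * k x y)"
      unfolding split_beta by (intro continuous_intros contk') auto
    from integral_continuous_on_param[OF this] show ?thesis
      by (simp add: \<kappa>_def[abs_def])
  qed
  have incr\<Phi>: "\<bar>\<Phi> x' - \<Phi> x\<bar> \<le> integral {x..x'} \<kappa>" if x: "a \<le> x" "x \<le> x'" "x' \<le> b" for x x'
  proof -
    let ?\<psi> = "\<lambda>y. f x' y - f x y"
    have "continuous_on {c..d} (\<lambda>v. integral {x..x'} (\<lambda>s. k s v))"
    proof -
      have "continuous_on ({c..d} \<times> cbox x x') (\<lambda>(v, s). k s v)"
        unfolding split_beta using x by (intro continuous_intros contk') auto
      from integral_continuous_on_param[OF this] show ?thesis by simp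
    qed
    then have "\<bar>(d - c) * (?\<psi> c + ?\<psi> d) / 2 - integral {c..d} ?\<psi>\<bar>
        \<le> integral {c..d} (\<lambda>y. \<bar>y - (c + d) / 2\<bar> * integral {x..x'} (\<lambda>s. k s y))"
      using trapezoid_defect_le(2)[OF \<open>c < d\<close>, of "\<lambda>v. integral {x..x'} (\<lambda>s. k s v)" ?\<psi>] incr x by blast
    moreover have "(d - c) * (?\<psi> c + ?\<psi> d) / 2 - integral {c..d} ?\<psi> = \<Phi> x' - \<Phi> x"
      using x by (simp add: \<Phi>_def integral_diff intf field_simps)
    \<comment> \<open>Swapping the order of integration writes the bound as an integral of
      \<open>\<kappa>\<close> over \<open>{x..x'}\<close>, the form the second application
      demands.\<close>
    moreover have "integral {c..d} (\<lambda>y. \<bar>y - (c + d) / 2\<bar> * integral {x..x'} (\<lambda>s. k s y))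
        = integral {x..x'} \<kappa>"
      using integral_swap_continuous[of x c x' d "\<lambda>s y. \<bar>y - (c + d) / 2\<bar> * k s y"] x
      by (simp add: \<kappa>_def[abs_def] cbox_Pair_eq split_beta continuous_intros contk' image_subset_iff)
    ultimately show ?thesis by simp
  qed
  note main = trapezoid_defect_le[OF \<open>a < b\<close> cont\<kappa>, of \<Phi>, OF incr\<Phi>]
  have "continuous_on {a..b} (\<lambda>x. (d - c) * (f x c + f x d) / 2)"
    using \<open>c < d\<close> by (intro continuous_intros cont1) auto
  then have "(\<lambda>x. (d - c) * (f x c + f x d) / 2) integrable_on {a..b}"
    by (rule integrable_continuous_real)
  \<comment> \<open>\<open>f\<close> is only given as separately continuous, so integrability of its
    inner integral is recovered from that of \<open>\<Phi>\<close>, which the one-dimensional lemma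
    supplies.\<close>
  from integrable_diff[OF this main(1)]
  have intI: "(\<lambda>x. integral {c..d} (f x)) integrable_on {a..b}"
    by (simp add: \<Phi>_def)
  have "integral {a..b} \<Phi> = (d - c) / 2 * integral {a..b} (\<lambda>x. f x c + f x d)
      - integral {a..b} (\<lambda>x. integral {c..d} (f x))"
    unfolding \<Phi>_def
    using integral_diff[OF \<open>(\<lambda>x. (d - c) * (f x c + f x d) / 2) integrable_on {a..b}\<close> intI]
    by (simp flip: integral_mult_right)
  moreover have "integral {c..d} (\<lambda>y. f a y + f b y) = integral {c..d} (f a) + integral {c..d} (f b)"
    using \<open>a < b\<close> by (intro integral_add intf) auto
  ultimately have "(b - a) * (\<Phi> a + \<Phi> b) / 2 - integral {a..b} \<Phi>
     = (b - a) * (d - c) * ((f a c + f a d + f b c + f b d) / 4)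
           + integral {a..b} (\<lambda>x. integral {c..d} (f x))
           - ((d - c) * integral {a..b} (\<lambda>x. f x c + f x d)
              + (b - a) * integral {c..d} (\<lambda>y. f a y + f b y)) / 2"
    by (simp add: \<Phi>_def field_simps)
  with main(2) show ?thesis by (simp add: \<kappa>_def)
qed

section \<open>Mean value inequality and mixed differences\<close>

lemma abs_diff_le_integral_bound:
  fixes \<phi> \<phi>' k :: "real \<Rightarrow> real"
  assumes "u \<le> v"
    and deriv: "\<And>x. x \<in> {u..v} \<Longrightarrow> (\<phi> has_vector_derivative \<phi>' x) (at x within {u..v})"
    and contk: "continuous_on {u..v} k"
    and le: "\<And>x. x \<in> {u..v} \<Longrightarrow> \<bar>\<phi>' x\<bar> \<le> k x"
  shows "\<bar>\<phi> v - \<phi> u\<bar> \<le> integral {u..v} k"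
proof (cases "u = v")
  case False
  let ?K = "\<lambda>x. integral {u..x} k"
  have K': "(?K has_vector_derivative k x) (at x within {u..v})" if "x \<in> {u..v}" for x
    using integral_has_vector_derivative[OF contk that] .
  \<comment> \<open>\<open>\<phi>'\<close> may fail to be integrable, so \<open>\<phi>\<close> is
    compared with the antiderivative \<open>?K\<close> through the mean value inequality instead of
    being recovered from \<open>\<phi>'\<close>.\<close>
  have "norm (\<phi> v - \<phi> u) \<le> ?K v - ?K u"
  proof (rule differentiable_bound_general[of u v \<phi> ?K \<phi>' k])
    show "(\<phi> has_vector_derivative \<phi>' x) (at x)" "(?K has_vector_derivative k x) (at x)"
      if "u < x" "x < v" for x
      using deriv[of x] K'[of x] that by (auto simp: at_within_Icc_at)
    show "continuous_on {u..v} \<phi>" "continuous_on {u..v} ?K"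
      using deriv K' continuous_on_vector_derivative by blast+
  qed (use False assms in auto)
  then show ?thesis by simp
qed simp

text \<open>The outer use of the mean value inequality runs in \<open>y\<close>, on
  \<open>f (x', v) - f (x, v)\<close>; its derivative is an increment of the second partial
  derivative, bounded by an inner use in \<open>x\<close>. This follows the order of differentiation
  in \<open>mixed_partial\<close>.\<close>

lemma mixed_difference_le:
  assumes pd: "partial_differentiable_on f {a..b} {c..d}" and "a < b" "c < d"
    and contk: "continuous_on ({a..b} \<times> {c..d}) (\<lambda>(x, y). k x y)"
    and le: "\<And>x y. x \<in> {a..b} \<Longrightarrow> y \<in> {c..d} \<Longrightarrow> \<bar>mixed_partial {a..b} {c..d} f (x, y)\<bar> \<le> k x y"
    and x: "a \<le> x" "x \<le> x'" "x' \<le> b" and y: "c \<le> y" "y \<le> y'" "y' \<le> d"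
  shows "\<bar>(f (x', y') - f (x, y')) - (f (x', y) - f (x, y))\<bar>
           \<le> integral {y..y'} (\<lambda>v. integral {x..x'} (\<lambda>s. k s v))"
proof -
  let ?D = "partial_snd {c..d} f"
  note contk' = continuous_on_curried_compose[OF contk]
  have D2: "((\<lambda>v. f (s, v)) has_vector_derivative ?D (s, v)) (at v within {y..y'})"
    if "s \<in> {a..b}" "v \<in> {y..y'}" for s v
  proof -
    have "(\<lambda>v. f (s, v)) differentiable (at v within {c..d})"
      using pd that y by (auto simp: partial_differentiable_on_def)
    then have "((\<lambda>v. f (s, v)) has_vector_derivative ?D (s, v)) (at v within {c..d})"
      by (simp add: partial_snd_def vector_derivative_works)
    then show ?thesis
      by (rule has_vector_derivative_within_subset) (use y in auto)
  qed
  have D12: "((\<lambda>u. ?D (u, v)) has_vector_derivative mixed_partial {a..b} {c..d} f (s, v)) (at s within {x..x'})"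
    if "s \<in> {x..x'}" "v \<in> {c..d}" for s v
  proof -
    have "(\<lambda>u. ?D (u, v)) differentiable (at s within {a..b})"
      using pd that x by (auto simp: partial_differentiable_on_def)
    then have "((\<lambda>u. ?D (u, v)) has_vector_derivative mixed_partial {a..b} {c..d} f (s, v))
        (at s within {a..b})"
      by (simp add: mixed_partial_def partial_fst_def vector_derivative_works)
    then show ?thesis
      by (rule has_vector_derivative_within_subset) (use x in auto)
  qed
  show ?thesis
  proof (rule abs_diff_le_integral_bound[where \<phi> = "\<lambda>v. f (x', v) - f (x, v)"
        and \<phi>' = "\<lambda>v. ?D (x', v) - ?D (x, v)"])
    show "((\<lambda>v. f (x', v) - f (x, v)) has_vector_derivative ?D (x', v) - ?D (x, v))
        (at v within {y..y'})" if "v \<in> {y..y'}" for v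
      using x that by (intro has_vector_derivative_diff D2) auto
    show "continuous_on {y..y'} (\<lambda>v. integral {x..x'} (\<lambda>s. k s v))"
    proof -
      have "continuous_on ({y..y'} \<times> cbox x x') (\<lambda>(v, s). k s v)"
        unfolding split_beta using x y by (intro continuous_intros contk') auto
      from integral_continuous_on_param[OF this] show ?thesis by simp
    qed
    show "\<bar>?D (x', v) - ?D (x, v)\<bar> \<le> integral {x..x'} (\<lambda>s. k s v)" if "v \<in> {y..y'}" for v
    proof (rule abs_diff_le_integral_bound[where \<phi> = "\<lambda>s. ?D (s, v)"
          and \<phi>' = "\<lambda>s. mixed_partial {a..b} {c..d} f (s, v)"])
      show "continuous_on {x..x'} (\<lambda>s. k s v)"
        using x y that by (intro contk' continuous_intros) auto
    qed (use D12 le x y that in auto)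
  qed (use y in simp)
qed

section \<open>Affine interpolation, nested later into the bilinear interpolant of four corner
  values\<close>

definition affine_interp :: "real \<Rightarrow> real \<Rightarrow> real \<Rightarrow> real \<Rightarrow> real \<Rightarrow> real" where
  "affine_interp a b A B x = ((b - x) * A + (x - a) * B) / (b - a)"

lemma affine_interp_nonneg:
  "a < b \<Longrightarrow> 0 \<le> A \<Longrightarrow> 0 \<le> B \<Longrightarrow> x \<in> {a..b} \<Longrightarrow> 0 \<le> affine_interp a b A B x"
  by (auto simp: affine_interp_def)

lemma continuous_on_affine_interp [continuous_intros]:
  assumes "a < b" "continuous_on S A" "continuous_on S B" "continuous_on S g"
  shows "continuous_on S (\<lambda>x. affine_interp a b (A x) (B x) (g x))"
  unfolding affine_interp_def using assms by (auto intro!: continuous_intros)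

text \<open>Serves to show that the mean over \<open>y\<close> of a bilinear interpolant is again
  affine in \<open>x\<close>, with averaged end values.\<close>

lemma affine_interp_average:
  "(affine_interp a b A B x + affine_interp a b C D x) / 2
     = affine_interp a b ((A + C) / 2) ((B + D) / 2) x"
proof -
  define r where "r = inverse (b - a)"
  show ?thesis
    unfolding affine_interp_def divide_inverse[of _ "b - a"] r_def[symmetric]
    by (simp add: field_simps)
qed

lemma has_integral_affine_interp:
  assumes "a < b"
  shows "(affine_interp a b A B has_integral (b - a) * ((A + B) / 2)) {a..b}"
proof -
  define r where "r = 1 / (b - a)"
  \<comment> \<open>Each square vanishes at one end point, so \<open>?P b - ?P a\<close> receives
    one term from \<open>B\<close> and one from \<open>A\<close>.\<close>
  let ?P = "\<lambda>x. (x - a)\<^sup>2 * B * r / 2 - (b - x)\<^sup>2 * A * r / 2"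
  have "(affine_interp a b A B has_integral ?P b - ?P a) {a..b}"
  proof (rule fundamental_theorem_of_calculus)
    fix x
    have "(?P has_real_derivative (x - a) * B * r + (b - x) * A * r) (at x within {a..b})"
      by (auto intro!: derivative_eq_intros simp: field_simps)
    also have "(x - a) * B * r + (b - x) * A * r = affine_interp a b A B x"
      using assms by (simp add: r_def affine_interp_def divide_inverse algebra_simps)
    finally show "(?P has_vector_derivative affine_interp a b A B x) (at x within {a..b})"
      by (simp add: has_real_derivative_iff_has_vector_derivative)
  qed (use assms in simp)
  moreover have "?P b - ?P a = (b - a) * ((b - a) * r) * ((A + B) / 2)"
    by (simp add: power2_eq_square field_simps)
  moreover have "(b - a) * r = 1"
    using assms by (simp add: r_def)
  ultimately show ?thesis by (metis mult.right_neutral)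
qed

section \<open>Hoelder's inequality with the midpoint weight\<close>

lemma has_integral_abs_minus_midpoint_powr:
  fixes p :: real
  assumes "a < b" "0 < p"
  shows "((\<lambda>x. \<bar>x - (a + b) / 2\<bar> powr p) has_integral
           2 * ((b - a) / 2) powr (p + 1) / (p + 1)) {a..b}"
proof -
  define m where "m = (a + b) / 2"
  have m: "a < m" "m < b" "m - a = (b - a) / 2" "b - m = (b - a) / 2"
    using \<open>a < b\<close> by (auto simp: m_def field_simps)
  have "((\<lambda>x. \<bar>x - m\<bar> powr p) has_integral
      (b - m) powr (p + 1) / (p + 1) - (m - m) powr (p + 1) / (p + 1)) {m..b}"
  \<comment> \<open>The derivative is taken only in the open interval, where the base of
    \<open>powr\<close> is positive; at \<open>m\<close> the boundary term is zero since
    \<open>0 powr (p + 1) = 0\<close>.\<close>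
  proof (rule fundamental_theorem_of_calculus_interior)
    show "continuous_on {m..b} (\<lambda>x. (x - m) powr (p + 1) / (p + 1))"
      using \<open>0 < p\<close> by (intro continuous_intros continuous_on_powr') auto
    show "((\<lambda>x. (x - m) powr (p + 1) / (p + 1)) has_vector_derivative \<bar>x - m\<bar> powr p) (at x)"
      if "x \<in> {m<..<b}" for x
      unfolding has_real_derivative_iff_has_vector_derivative[symmetric]
      using that \<open>0 < p\<close> by (auto intro!: derivative_eq_intros)
  qed (use m in simp)
  moreover have "((\<lambda>x. \<bar>x - m\<bar> powr p) has_integral
      - ((m - m) powr (p + 1)) / (p + 1) - - ((m - a) powr (p + 1)) / (p + 1)) {a..m}"
  proof (rule fundamental_theorem_of_calculus_interior)
    show "continuous_on {a..m} (\<lambda>x. - ((m - x) powr (p + 1)) / (p + 1))"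
      using \<open>0 < p\<close> by (intro continuous_intros continuous_on_powr') auto
    show "((\<lambda>x. - ((m - x) powr (p + 1)) / (p + 1)) has_vector_derivative \<bar>x - m\<bar> powr p) (at x)"
      if "x \<in> {a<..<m}" for x
      unfolding has_real_derivative_iff_has_vector_derivative[symmetric]
      using that \<open>0 < p\<close> by (auto intro!: derivative_eq_intros)
  qed (use m in simp)
  ultimately have "((\<lambda>x. \<bar>x - m\<bar> powr p) has_integral
      (m - a) powr (p + 1) / (p + 1) + (b - m) powr (p + 1) / (p + 1)) {a..b}"
    using m(1,2) \<open>0 < p\<close> by (intro has_integral_combine[of a m b]) auto
  then show ?thesis by (simp add: m(3,4) flip: m_def)
qed

text \<open>Divide each factor by its norm, \<open>F powr (1 / p)\<close> or
  \<open>G powr (1 / q)\<close>, apply Young's inequality pointwise and integrate: the bound becomes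
  \<open>1 / p + 1 / q = 1\<close>. Positivity of \<open>F\<close> and \<open>G\<close> permits the
  division.\<close>

lemma Holder_integral_le:
  fixes f g :: "real \<Rightarrow> real" and p q :: real
  assumes "p > 1" "q > 1" "1 / p + 1 / q = 1"
    and cont: "continuous_on {a..b} f" "continuous_on {a..b} g"
    and nonneg: "\<And>x. x \<in> {a..b} \<Longrightarrow> 0 \<le> f x" "\<And>x. x \<in> {a..b} \<Longrightarrow> 0 \<le> g x"
    and F: "((\<lambda>x. f x powr p) has_integral F) {a..b}" "0 < F"
    and G: "((\<lambda>x. g x powr q) has_integral G) {a..b}" "0 < G"
  shows "integral {a..b} (\<lambda>x. f x * g x) \<le> F powr (1 / p) * G powr (1 / q)"
proof -
  let ?C = "F powr (1 / p) * G powr (1 / q)"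
  have fg: "(\<lambda>x. f x * g x) integrable_on {a..b}"
    by (intro integrable_continuous_real continuous_intros cont)
  have "((\<lambda>x. f x powr p / F / p + g x powr q / G / q) has_integral F / F / p + G / G / q) {a..b}"
    using F G by (intro has_integral_add has_integral_divide) auto
  then have I: "((\<lambda>x. f x powr p / F / p + g x powr q / G / q) has_integral 1) {a..b}"
    using F(2) G(2) assms(3) by simp
  have "integral {a..b} (\<lambda>x. f x * g x) / ?C \<le> 1"
  proof (rule has_integral_le[OF has_integral_divide[OF integrable_integral[OF fg]] I])
    fix x assume x: "x \<in> {a..b}"
    have pq: "(F powr (1 / p)) powr p = F" "(G powr (1 / q)) powr q = G"
      using assms(1,2) F(2) G(2) by (simp_all add: powr_powr)
    have "(f x / F powr (1 / p)) * (g x / G powr (1 / q))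
        \<le> (f x / F powr (1 / p)) powr p / p + (g x / G powr (1 / q)) powr q / q"
      by (rule Youngs_inequality[OF assms(1-3)]) (simp_all add: nonneg[OF x])
    then show "f x * g x / ?C \<le> f x powr p / F / p + g x powr q / G / q"
      by (simp add: powr_divide nonneg[OF x] pq)
  qed
  then show ?thesis
    using F(2) G(2) by (simp add: pos_divide_le_eq)
qed

text \<open>Hoelder with the weight as the \<open>p\<close>-factor and the root as the
  \<open>q\<close>-factor: the \<open>q\<close>-th power of the root is affine, with mean
  \<open>(A + B) / 2\<close>.\<close>

lemma integral_abs_minus_midpoint_times_affine_root_le:
  fixes p q :: real
  assumes "a < b" "p > 1" "q > 1" "1 / p + 1 / q = 1" "0 \<le> A" "0 \<le> B"
  shows "integral {a..b} (\<lambda>x. \<bar>x - (a + b) / 2\<bar> * affine_interp a b A B x powr (1 / q))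
          \<le> (b - a)\<^sup>2 / (2 * (p + 1) powr (1 / p)) * ((A + B) / 2) powr (1 / q)"
\<comment> \<open>Hoelder is available only for a positive integral of the \<open>q\<close>-th
  power; if \<open>A + B = 0\<close>, both end values vanish and both sides are zero.\<close>
proof (cases "A + B = 0")
  case True
  with assms have "A = 0" "B = 0" by auto
  then show ?thesis by (simp add: affine_interp_def)
next
  case False
  with assms have AB: "0 < A + B" by linarith
  define h where "h = (b - a) / 2"
  have h: "0 < h" "b - a = 2 * h" using assms by (auto simp: h_def)
  have pow: "((\<lambda>x. (affine_interp a b A B x powr (1 / q)) powr q) has_integral (b - a) * ((A + B) / 2)) {a..b}"
    using has_integral_affine_interp[OF \<open>a < b\<close>, of A B]
    by (rule has_integral_eq[rotated]) (use assms affine_interp_nonneg[of a b A B] in \<open>simp add: powr_powr\<close>)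
  have "integral {a..b} (\<lambda>x. \<bar>x - (a + b) / 2\<bar> * affine_interp a b A B x powr (1 / q))
      \<le> (2 * ((b - a) / 2) powr (p + 1) / (p + 1)) powr (1 / p) * ((b - a) * ((A + B) / 2)) powr (1 / q)"
  proof (rule Holder_integral_le[OF assms(2-4) _ _ _ _ _ _ pow])
    show "((\<lambda>x. \<bar>x - (a + b) / 2\<bar> powr p) has_integral 2 * ((b - a) / 2) powr (p + 1) / (p + 1)) {a..b}"
      using assms(1,2) by (intro has_integral_abs_minus_midpoint_powr) auto
    show "0 < 2 * ((b - a) / 2) powr (p + 1) / (p + 1)" "0 < (b - a) * ((A + B) / 2)"
      using assms(1,2) AB by auto
    show "continuous_on {a..b} (\<lambda>x. \<bar>x - (a + b) / 2\<bar>)"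
      by (intro continuous_intros)
    show "continuous_on {a..b} (\<lambda>x. affine_interp a b A B x powr (1 / q))"
      by (intro continuous_on_powr' continuous_on_affine_interp continuous_on_const continuous_on_id)
         (use assms affine_interp_nonneg[of a b A B] in auto)
  qed auto
  also have "\<dots> = (b - a)\<^sup>2 / (2 * (p + 1) powr (1 / p)) * ((A + B) / 2) powr (1 / q)"
  proof -
    \<comment> \<open>Since \<open>1 / p + 1 / q = 1\<close>, the exponents of 2 add up to 1 and
      those of \<open>h\<close> to 2, leaving \<open>2 * h\<^sup>2 = (b - a)\<^sup>2 / 2\<close> in
      the numerator.\<close>
    have "(2 * h powr (p + 1) / (p + 1)) powr (1 / p) * (2 * h) powr (1 / q)
      = (2 powr (1 / p) * 2 powr (1 / q)) * (h powr ((p + 1) / p) * h powr (1 / q)) / (p + 1) powr (1 / p)"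
      using h assms by (simp add: powr_divide powr_mult powr_powr)
    also have "2 powr (1 / p) * 2 powr (1 / q) = (2::real)"
      using assms by (simp flip: powr_add)
    also have "h powr ((p + 1) / p) * h powr (1 / q) = h\<^sup>2"
    proof -
      have "(p + 1) / p + 1 / q = 2" using assms by (simp add: add_divide_distrib)
      then show ?thesis using h by (simp flip: powr_add)
    qed
    finally show ?thesis
      unfolding h(2) using h(1) AB by (subst powr_mult) (simp_all add: power2_eq_square flip: mult.assoc)
  qed
  finally show ?thesis .
qed

section \<open>The bilinear majorant from coordinated convexity, and the final estimate\<close>

theorem theorem3:
  fixes a b c d p q :: real and f :: "real \<times> real \<Rightarrow> real"
  assumes "a < b" and "c < d"
    and "partial_differentiable_on f {a..b} {c..d}"
    and "q > 1" and "1 / p + 1 / q = 1"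
    and "coordinated_convex_on {a..b} {c..d}
           (\<lambda>z. \<bar>mixed_partial {a..b} {c..d} f z\<bar> powr q)"
  shows
    "let A = 1 / 2 * (1 / (b - a) * integral {a..b} (\<lambda>x. f (x, c) + f (x, d))
                    + 1 / (d - c) * integral {c..d} (\<lambda>y. f (a, y) + f (b, y)));
         f_ts = mixed_partial {a..b} {c..d} f
     in \<bar>(f (a, c) + f (a, d) + f (b, c) + f (b, d)) / 4
          + 1 / ((b - a) * (d - c)) * integral {a..b} (\<lambda>x. integral {c..d} (\<lambda>y. f (x, y)))
          - A\<bar>
        \<le> (b - a) * (d - c) / (4 * (p + 1) powr (2 / p))
           * ((\<bar>f_ts (a, c)\<bar> powr q + \<bar>f_ts (a, d)\<bar> powr q
               + \<bar>f_ts (b, c)\<bar> powr q + \<bar>f_ts (b, d)\<bar> powr q) / 4) powr (1 / q)"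
proof -
  let ?R = "\<lambda>z. \<bar>mixed_partial {a..b} {c..d} f z\<bar> powr q"
  \<comment> \<open>\<open>A0\<close> and \<open>A1\<close> interpolate the corner values of
    \<open>?R\<close> along the edges \<open>y = c\<close> and \<open>y = d\<close>;
    \<open>G\<close> is the root of the mean over \<open>y\<close> of the bilinear interpolant,
    \<open>Q\<close> the mean of the four corner values, and \<open>?C l\<close> the one-dimensional
    constant for length \<open>l\<close>.\<close>
  define A0 where "A0 = affine_interp a b (?R (a, c)) (?R (b, c))"
  define A1 where "A1 = affine_interp a b (?R (a, d)) (?R (b, d))"
  define k where "k x y = affine_interp c d (A0 x) (A1 x) y powr (1 / q)" for x y
  define G where "G x = affine_interp a b ((?R (a, c) + ?R (a, d)) / 2) ((?R (b, c) + ?R (b, d)) / 2) x powr (1 / q)" for x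
  define Q where "Q = (?R (a, c) + ?R (a, d) + ?R (b, c) + ?R (b, d)) / 4"
  let ?C = "\<lambda>l. l\<^sup>2 / (2 * (p + 1) powr (1 / p))"
  \<comment> \<open>\<open>1 / p = 1 - 1 / q\<close> lies strictly between 0 and 1, which forces
    \<open>p > 1\<close>.\<close>
  have "1 / p < 1" "0 < 1 / p"
    using \<open>q > 1\<close> \<open>1 / p + 1 / q = 1\<close> by (auto simp: eq_diff_eq[symmetric])
  then have "p > 1"
    by (simp add: divide_less_eq split: if_splits)
  have A_nonneg: "0 \<le> A0 x" "0 \<le> A1 x" if "x \<in> {a..b}" for x
    using that \<open>a < b\<close> by (simp_all add: A0_def A1_def affine_interp_nonneg)
  have contA: "continuous_on S (\<lambda>z. A0 (g z))" "continuous_on S (\<lambda>z. A1 (g z))"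
    if "continuous_on S g" for S and g :: "real \<times> real \<Rightarrow> real"
    unfolding A0_def A1_def using that \<open>a < b\<close> by (intro continuous_intros; simp)+
  \<comment> \<open>The interpolant may vanish, so continuity of its root rests on a nonnegative
    base and the positive exponent \<open>1 / q\<close>.\<close>
  have contk: "continuous_on ({a..b} \<times> {c..d}) (\<lambda>(x, y). k x y)"
    unfolding k_def split_beta
    by (intro continuous_on_powr' continuous_on_affine_interp contA continuous_on_const
          continuous_on_fst continuous_on_snd continuous_on_id)
       (use \<open>c < d\<close> \<open>q > 1\<close> A_nonneg in \<open>auto intro!: affine_interp_nonneg\<close>)
  have mixed_le: "\<bar>mixed_partial {a..b} {c..d} f (x, y)\<bar> \<le> k x y"
    if x: "x \<in> {a..b}" and y: "y \<in> {c..d}" for x y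
  proof -
    \<comment> \<open>\<open>t\<close> and \<open>s\<close> are the barycentric weights of
      \<open>x\<close> and \<open>y\<close>; with them, coordinated convexity applied at the four
      corners has the bilinear interpolant as its right-hand side.\<close>
    define t where "t = (b - x) / (b - a)"
    define s where "s = (d - y) / (d - c)"
    have ts: "t \<in> {0..1}" "s \<in> {0..1}"
      using x y \<open>a < b\<close> \<open>c < d\<close> by (auto simp: t_def s_def)
    have t1: "1 - t = (x - a) / (b - a)" and s1: "1 - s = (y - c) / (d - c)"
      using \<open>a < b\<close> \<open>c < d\<close> by (auto simp: t_def s_def field_simps)
    have "t * (b - a) = b - x" "s * (d - c) = d - y"
      using \<open>a < b\<close> \<open>c < d\<close> by (auto simp: t_def s_def)
    then have xy: "t * a + (1 - t) * b = x" "s * c + (1 - s) * d = y"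
      by (auto simp: algebra_simps)
    have interp: "affine_interp a b A B x = t * A + (1 - t) * B"
      "affine_interp c d A B y = s * A + (1 - s) * B" for A B
      unfolding affine_interp_def t1 s1 by (simp_all add: t_def s_def add_divide_distrib)
    have "?R (t * a + (1 - t) * b, s * c + (1 - s) * d)
        \<le> t * s * ?R (a, c) + s * (1 - t) * ?R (b, c) + t * (1 - s) * ?R (a, d)
          + (1 - t) * (1 - s) * ?R (b, d)"
      using assms(6) ts \<open>a < b\<close> \<open>c < d\<close> unfolding coordinated_convex_on_def by auto
    also have "\<dots> = affine_interp c d (A0 x) (A1 x) y"
      unfolding A0_def A1_def interp by (simp add: algebra_simps)
    finally have "?R (x, y) \<le> affine_interp c d (A0 x) (A1 x) y"
      unfolding xy .
    then have "?R (x, y) powr (1 / q) \<le> k x y"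
      unfolding k_def using \<open>q > 1\<close> by (intro powr_mono2) auto
    then show ?thesis
      using \<open>q > 1\<close> by (simp add: powr_powr)
  qed
  have pd: "partial_differentiable_on f {a..b} {c..d}" by fact
  have cont1: "continuous_on {a..b} (\<lambda>x. f (x, y))" if "y \<in> {c..d}" for y
    using pd that by (auto simp: partial_differentiable_on_def continuous_on_eq_continuous_within
      intro!: differentiable_imp_continuous_within)
  have cont2: "continuous_on {c..d} (\<lambda>y. f (x, y))" if "x \<in> {a..b}" for x
    using pd that by (auto simp: partial_differentiable_on_def continuous_on_eq_continuous_within
      intro!: differentiable_imp_continuous_within)
  \<comment> \<open>\<open>E\<close> is the quantity inside the absolute value of the claim,
    multiplied by the area of the rectangle.\<close>
  define E where "E = (b - a) * (d - c) * ((f (a, c) + f (a, d) + f (b, c) + f (b, d)) / 4)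
           + integral {a..b} (\<lambda>x. integral {c..d} (\<lambda>y. f (x, y)))
           - ((d - c) * integral {a..b} (\<lambda>x. f (x, c) + f (x, d))
              + (b - a) * integral {c..d} (\<lambda>y. f (a, y) + f (b, y))) / 2"
  have "\<bar>E\<bar> \<le> integral {a..b} (\<lambda>x. \<bar>x - (a + b) / 2\<bar> *
              integral {c..d} (\<lambda>y. \<bar>y - (c + d) / 2\<bar> * k x y))"
    unfolding E_def
    using rectangle_trapezoid_defect_le[OF \<open>a < b\<close> \<open>c < d\<close> contk, of "\<lambda>x y. f (x, y)",
      OF cont1 cont2 mixed_difference_le[OF pd \<open>a < b\<close> \<open>c < d\<close> contk mixed_le]] .
  \<comment> \<open>For fixed \<open>x\<close> the one-dimensional estimate in \<open>y\<close> has
    end values \<open>A0 x\<close> and \<open>A1 x\<close>. Their mean is affine in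
    \<open>x\<close>, so \<open>G\<close> is again a root of an affine function and the same
    estimate can be repeated in \<open>x\<close>.\<close>
  also have "\<dots> \<le> integral {a..b} (\<lambda>x. ?C (d - c) * (\<bar>x - (a + b) / 2\<bar> * G x))"
  proof (rule integral_le)
    note contk' = continuous_on_curried_compose[OF contk]
    have "continuous_on ({a..b} \<times> cbox c d) (\<lambda>(x, y). \<bar>y - (c + d) / 2\<bar> * k x y)"
      unfolding split_beta by (intro continuous_intros contk') auto
    from integral_continuous_on_param[OF this]
    have "continuous_on {a..b} (\<lambda>x. integral {c..d} (\<lambda>y. \<bar>y - (c + d) / 2\<bar> * k x y))"
      by simp
    then show "(\<lambda>x. \<bar>x - (a + b) / 2\<bar> * integral {c..d} (\<lambda>y. \<bar>y - (c + d) / 2\<bar> * k x y))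
        integrable_on {a..b}"
      by (intro integrable_continuous_real continuous_intros)
    have "continuous_on {a..b} G"
      unfolding G_def
      by (intro continuous_on_powr' continuous_on_affine_interp continuous_on_const continuous_on_id)
         (use \<open>a < b\<close> \<open>q > 1\<close> in \<open>auto intro!: affine_interp_nonneg\<close>)
    then show "(\<lambda>x. ?C (d - c) * (\<bar>x - (a + b) / 2\<bar> * G x)) integrable_on {a..b}"
      using \<open>p > 1\<close> by (intro integrable_continuous_real continuous_intros) auto
    fix x assume x: "x \<in> {a..b}"
    have "(A0 x + A1 x) / 2
        = affine_interp a b ((?R (a, c) + ?R (a, d)) / 2) ((?R (b, c) + ?R (b, d)) / 2) x"
      unfolding A0_def A1_def by (rule affine_interp_average)
    with integral_abs_minus_midpoint_times_affine_root_le[OF \<open>c < d\<close> \<open>p > 1\<close> \<open>q > 1\<close>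
        \<open>1 / p + 1 / q = 1\<close> A_nonneg[OF x]]
    have "integral {c..d} (\<lambda>y. \<bar>y - (c + d) / 2\<bar> * k x y) \<le> ?C (d - c) * G x"
      by (simp only: k_def G_def)
    from mult_left_mono[OF this abs_ge_zero[of "x - (a + b) / 2"]]
    show "\<bar>x - (a + b) / 2\<bar> * integral {c..d} (\<lambda>y. \<bar>y - (c + d) / 2\<bar> * k x y)
        \<le> ?C (d - c) * (\<bar>x - (a + b) / 2\<bar> * G x)"
      by (simp only: mult.left_commute)
  qed
  also have "\<dots> = ?C (d - c) * integral {a..b} (\<lambda>x. \<bar>x - (a + b) / 2\<bar> * G x)"
    by (rule integral_mult_right)
  also have "\<dots> \<le> ?C (d - c) * (?C (b - a) *
      (((?R (a, c) + ?R (a, d)) / 2 + (?R (b, c) + ?R (b, d)) / 2) / 2) powr (1 / q))"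
    unfolding G_def using \<open>p > 1\<close>
    by (intro mult_left_mono integral_abs_minus_midpoint_times_affine_root_le
      \<open>a < b\<close> \<open>q > 1\<close> \<open>1 / p + 1 / q = 1\<close>) auto
  also have "((?R (a, c) + ?R (a, d)) / 2 + (?R (b, c) + ?R (b, d)) / 2) / 2 = Q"
    by (simp add: Q_def add_divide_distrib)
  \<comment> \<open>The two constants multiply to the squared area over
    \<open>4 * (p + 1) powr (2 / p)\<close>; one factor of the area is split off to cancel the one
    in \<open>E\<close>.\<close>
  also have "?C (d - c) * (?C (b - a) * Q powr (1 / q))
      = (b - a) * (d - c) * ((b - a) * (d - c) / (4 * (p + 1) powr (2 / p)) * Q powr (1 / q))"
  proof -
    have "(p + 1) powr (2 / p) = (p + 1) powr (1 / p) * (p + 1) powr (1 / p)"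
      by (simp flip: powr_add)
    then show ?thesis by (simp add: power2_eq_square)
  qed
  finally have "\<bar>E\<bar> \<le> (b - a) * (d - c) * ((b - a) * (d - c) / (4 * (p + 1) powr (2 / p)) * Q powr (1 / q))" .
  moreover have "0 < (b - a) * (d - c)"
    using \<open>a < b\<close> \<open>c < d\<close> by simp
  ultimately have "\<bar>E / ((b - a) * (d - c))\<bar> \<le> (b - a) * (d - c) / (4 * (p + 1) powr (2 / p)) * Q powr (1 / q)"
    by (simp only: abs_divide abs_of_pos pos_divide_le_eq mult.commute)
  also have "E / ((b - a) * (d - c)) = (f (a, c) + f (a, d) + f (b, c) + f (b, d)) / 4
          + 1 / ((b - a) * (d - c)) * integral {a..b} (\<lambda>x. integral {c..d} (\<lambda>y. f (x, y)))
          - 1 / 2 * (1 / (b - a) * integral {a..b} (\<lambda>x. f (x, c) + f (x, d))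
                    + 1 / (d - c) * integral {c..d} (\<lambda>y. f (a, y) + f (b, y)))"
    using \<open>a < b\<close> \<open>c < d\<close> by (simp add: E_def diff_divide_distrib add_divide_distrib mult.commute)
  finally show ?thesis
    unfolding Let_def Q_def .
qed

end
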